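(* Let $(X,d,\mu)$ be an Ahlfors $Q$-regular metric measure space ($Q\ge1$, $\mu$ Borel regular) supporting a weak $(1,1)$-Poincaré inequality. Then every $A_1$-weight on $X$ is a strong $A_\infty$-weight.
   Context: $\mu$ is Ahlfors $Q$-regular if there is $c_A\ge1$ with $c_A^{-1}r^Q\le\mu(B(x,r))\le c_A r^Q$ for all $x\in X$, $r>0$. $X$ supports a weak $(1,1)$-Poincaré inequality if there are $c_P,\lambda>0$ such that for every ball $B=B(x,r)$, every $u\in L^1_{loc}(X)$ and every upper gradient $g$ of $u$, $\frac{1}{\mu(B)}\int_B|u-u_B|\,d\mu\le c_P r\frac{1}{\mu(\lambda B)}\int_{\lambda B}g\,d\mu$, where $u_B$ is the mean of $u$ on $B$, $\lambda B$ is the concentric ball of radius $\lambda r$, and $g\ge0$ Borel is an upper gradient of $u$ if $|u(x)-u(y)|\le\int_\gamma g\,ds$ for every rectifiable curve $\gamma$ joining $x$ and $y$. A nonnegative $\omega$ is an $A_1$-weight if there is $c>0$ with $\frac{1}{\mu(B)}\int_B\omega\,d\mu\le c\,\operatorname{ess\,inf}_B\omega$ for all balls $B$. For a doubling measure $\nu$, $\delta_\nu(x,y)=[\nu(B(x,d(x,y)))+\nu(B(y,d(x,y)))]^{1/Q}$. A doubling measure $\nu$ is a metric doubling measure if there are a metric $\delta$ on $X$ and $C>0$ with $C^{-1}\delta(x,y)\le\delta_\nu(x,y)\le C\delta(x,y)$ for all $x,y$. A function $\omega\in L^1_{loc}(X)$, $\omega\ge0$, is a strong $A_\infty$-weight if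 $d\nu=\omega\,d\mu$ is a metric doubling measure.
   Formalization: The A_1-weight is additionally assumed not to vanish almost everywhere, since ω = 0 satisfies the A_1 condition but is not a strong A_∞-weight; weights are taken as real-valued Borel functions. *)

theory Defs
  imports "HOL-Analysis.Analysis"
begin

definition curve_length :: "(real \<Rightarrow> 'a::metric_space) \<Rightarrow> real \<Rightarrow> real \<Rightarrow> ennreal" where
  "curve_length \<gamma> a b =
     (SUP ts \<in> {ts. ts \<noteq> [] \<and> sorted ts \<and> hd ts = a \<and> last ts = b}.
        (\<Sum>i < length ts - 1. ennreal (dist (\<gamma> (ts ! i)) (\<gamma> (ts ! Suc i)))))"

definition rectifiable_curve :: "(real \<Rightarrow> 'a::metric_space) \<Rightarrow> real \<Rightarrow> real \<Rightarrow> bool" where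
  "rectifiable_curve \<gamma> a b \<longleftrightarrow> a \<le> b \<and> continuous_on {a..b} \<gamma> \<and> curve_length \<gamma> a b < \<infinity>"

definition arc_length_param :: "(real \<Rightarrow> 'a::metric_space) \<Rightarrow> real \<Rightarrow> real \<Rightarrow> real \<Rightarrow> 'a" where
  "arc_length_param \<gamma> a b s = \<gamma> (SOME t. a \<le> t \<and> t \<le> b \<and> curve_length \<gamma> a t = ennreal s)"

definition line_integral :: "('a::metric_space \<Rightarrow> ennreal) \<Rightarrow> (real \<Rightarrow> 'a) \<Rightarrow> real \<Rightarrow> real \<Rightarrow> ennreal" where
  "line_integral g \<gamma> a b =
     (\<integral>\<^sup>+ s \<in> {0 .. enn2real (curve_length \<gamma> a b)}. g (arc_length_param \<gamma> a b s) \<partial>lborel)"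

definition upper_gradient :: "('a::metric_space \<Rightarrow> real) \<Rightarrow> ('a \<Rightarrow> ennreal) \<Rightarrow> bool" where
  "upper_gradient u g \<longleftrightarrow> g \<in> borel_measurable borel \<and>
     (\<forall>\<gamma> a b. rectifiable_curve \<gamma> a b \<longrightarrow>
        ennreal \<bar>u (\<gamma> a) - u (\<gamma> b)\<bar> \<le> line_integral g \<gamma> a b)"

definition loc_integrable :: "'a::metric_space measure \<Rightarrow> ('a \<Rightarrow> real) \<Rightarrow> bool" where
  "loc_integrable \<mu> u \<longleftrightarrow> u \<in> borel_measurable \<mu> \<and>
     (\<forall>x r. set_integrable \<mu> (ball x r) u)"

definition ahlfors_regular :: "'a::metric_space measure \<Rightarrow> real \<Rightarrow> bool" where
  "ahlfors_regular \<mu> Q \<longleftrightarrow> (\<exists>cA\<ge>1. \<forall>x. \<forall>r>0.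
      ennreal (r powr Q / cA) \<le> emeasure \<mu> (ball x r) \<and>
      emeasure \<mu> (ball x r) \<le> ennreal (cA * r powr Q))"

definition mean_value :: "'a::metric_space measure \<Rightarrow> 'a set \<Rightarrow> ('a \<Rightarrow> real) \<Rightarrow> real" where
  "mean_value \<mu> B u = (LINT y:B|\<mu>. u y) / measure \<mu> B"

definition weak_11_poincare :: "'a::metric_space measure \<Rightarrow> bool" where
  "weak_11_poincare \<mu> \<longleftrightarrow> (\<exists>cP>0. \<exists>lam>0. \<forall>x. \<forall>r>0. \<forall>u g.
      loc_integrable \<mu> u \<and> upper_gradient u g \<longrightarrow>
      (\<integral>\<^sup>+ y \<in> ball x r. ennreal \<bar>u y - mean_value \<mu> (ball x r) u\<bar> \<partial>\<mu>) / emeasure \<mu> (ball x r)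
        \<le> ennreal (cP * r) *
          ((\<integral>\<^sup>+ y \<in> ball x (lam * r). g y \<partial>\<mu>) / emeasure \<mu> (ball x (lam * r))))"

definition ess_inf_on :: "'a measure \<Rightarrow> 'a set \<Rightarrow> ('a \<Rightarrow> ennreal) \<Rightarrow> ennreal" where
  "ess_inf_on \<mu> B f = Sup {t::ennreal. AE y in \<mu>. y \<in> B \<longrightarrow> t \<le> f y}"

definition A1_weight :: "'a::metric_space measure \<Rightarrow> ('a \<Rightarrow> real) \<Rightarrow> bool" where
  "A1_weight \<mu> \<omega> \<longleftrightarrow> \<omega> \<in> borel_measurable \<mu> \<and> (\<forall>x. 0 \<le> \<omega> x) \<and>
     (\<exists>c>0. \<forall>x. \<forall>r>0.
        (\<integral>\<^sup>+ y \<in> ball x r. ennreal (\<omega> y) \<partial>\<mu>) / emeasure \<mu> (ball x r)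
          \<le> ennreal c * ess_inf_on \<mu> (ball x r) (\<lambda>y. ennreal (\<omega> y)))"

definition doubling_measure :: "'a::metric_space measure \<Rightarrow> bool" where
  "doubling_measure \<nu> \<longleftrightarrow> (\<exists>C. \<forall>x. \<forall>r>0.
      0 < emeasure \<nu> (ball x r) \<and> emeasure \<nu> (ball x r) < \<infinity> \<and>
      emeasure \<nu> (ball x (2 * r)) \<le> ennreal C * emeasure \<nu> (ball x r))"

definition delta_measure :: "'a::metric_space measure \<Rightarrow> real \<Rightarrow> 'a \<Rightarrow> 'a \<Rightarrow> real" where
  "delta_measure \<nu> Q x y =
     (measure \<nu> (ball x (dist x y)) + measure \<nu> (ball y (dist x y))) powr (1 / Q)"

definition is_metric :: "('a \<Rightarrow> 'a \<Rightarrow> real) \<Rightarrow> bool" where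
  "is_metric \<delta> \<longleftrightarrow> (\<forall>x y. \<delta> x y = 0 \<longleftrightarrow> x = y) \<and> (\<forall>x y. \<delta> x y = \<delta> y x) \<and>
     (\<forall>x y z. \<delta> x z \<le> \<delta> x y + \<delta> y z)"

definition metric_doubling_measure :: "'a::metric_space measure \<Rightarrow> real \<Rightarrow> bool" where
  "metric_doubling_measure \<nu> Q \<longleftrightarrow> doubling_measure \<nu> \<and>
     (\<exists>\<delta> C. is_metric \<delta> \<and> C > 0 \<and>
        (\<forall>x y. \<delta> x y / C \<le> delta_measure \<nu> Q x y \<and> delta_measure \<nu> Q x y \<le> C * \<delta> x y))"

definition strong_A_infinity_weight :: "'a::metric_space measure \<Rightarrow> real \<Rightarrow> ('a \<Rightarrow> real) \<Rightarrow> bool" where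
  "strong_A_infinity_weight \<mu> Q \<omega> \<longleftrightarrow> loc_integrable \<mu> \<omega> \<and> (\<forall>x. 0 \<le> \<omega> x) \<and>
     metric_doubling_measure (density \<mu> (\<lambda>x. ennreal (\<omega> x))) Q"

end

theory Submission
  imports Defs
begin

text \<open>
  For an \<open>A\<^sub>1\<close>-weight, \<open>\<nu>(B)/\<mu>(B)\<close> is comparable to the essential infimum of \<open>\<omega>\<close> over \<open>B\<close>,
  which can only increase when the ball shrinks. With Ahlfors regularity this gives
  \<open>s\<^sup>Q \<nu>(B(x,r)) \<le> K r\<^sup>Q \<nu>(B(z,s))\<close> whenever \<open>B(z,s) \<subseteq> B(x,r)\<close>.
  This estimate implies that \<open>\<nu>\<close> is doubling, and that for \<open>R = d(x,y)\<close> the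
  truncated distance \<open>z \<mapsto> min (d(x,z)) R\<close>, scaled by a constant multiple of
  \<open>\<nu>(B(x,2R))\<^bsup>1/Q\<^esup>/R\<close>, is 1-Lipschitz with respect to \<open>\<delta>\<^sub>\<nu>\<close>. Hence the metric
  \<open>\<delta>(x,y) = sup \<bar>f(x) - f(y)\<bar>\<close>, the supremum being over all functions that are 1-Lipschitz
  with respect to \<open>\<delta>\<^sub>\<nu>\<close>, is comparable to \<open>\<delta>\<^sub>\<nu>\<close>.
\<close>

section \<open>The metric generated by functions that are 1-Lipschitz for a quasi-distance\<close>

definition lipschitz_dual :: "('a \<Rightarrow> 'a \<Rightarrow> real) \<Rightarrow> 'a \<Rightarrow> 'a \<Rightarrow> real" where
  "lipschitz_dual q x y = (SUP f \<in> {f. \<forall>z w. \<bar>f z - f w\<bar> \<le> q z w}. \<bar>f x - f y\<bar>)"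

lemma bdd_above_lipschitz_dual:
  fixes q :: "'a \<Rightarrow> 'a \<Rightarrow> real"
  shows "bdd_above ((\<lambda>f. \<bar>f x - f y\<bar>) ` {f. \<forall>z w. \<bar>f z - f w\<bar> \<le> q z w})"
  by (rule bdd_aboveI[of _ "q x y"]) auto

lemma le_lipschitz_dual:
  assumes "\<And>z w. \<bar>f z - f w\<bar> \<le> q z w"
  shows "\<bar>f x - f y\<bar> \<le> lipschitz_dual q x y"
  unfolding lipschitz_dual_def
  by (rule cSUP_upper[OF _ bdd_above_lipschitz_dual]) (use assms in auto)

lemma lipschitz_dual_le:
  fixes q :: "'a \<Rightarrow> 'a \<Rightarrow> real"
  assumes "\<And>z w. 0 \<le> q z w"
    and "\<And>f. (\<And>z w. \<bar>f z - f w\<bar> \<le> q z w) \<Longrightarrow> \<bar>f x - f y\<bar> \<le> t"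
  shows "lipschitz_dual q x y \<le> t"
  unfolding lipschitz_dual_def
proof (rule cSUP_least)
  \<comment> \<open>A real supremum is a least upper bound only over a nonempty set; nonnegativity
    of \<open>q\<close> makes the zero function admissible.\<close>
  have "(\<lambda>_. 0) \<in> {f. \<forall>z w. \<bar>f z - f w\<bar> \<le> q z w}"
    using assms(1) by auto
  then show "{f. \<forall>z w. \<bar>f z - f w\<bar> \<le> q z w} \<noteq> {}"
    by (metis empty_iff)
qed (use assms(2) in auto)

text \<open>Each \<open>\<bar>f x - f y\<bar>\<close> is a pseudometric and suprema preserve this,
  so \<open>q\<close> itself need not satisfy the triangle inequality; only separation of points has
  to be supplied. For symmetric \<open>q\<close> this is the largest pseudometric below
  \<open>q\<close>.\<close>

lemma is_metric_lipschitz_dual: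
  fixes q :: "'a \<Rightarrow> 'a \<Rightarrow> real"
  assumes nonneg: "\<And>z w. 0 \<le> q z w"
    and pos: "\<And>x y. x \<noteq> y \<Longrightarrow> 0 < lipschitz_dual q x y"
  shows "is_metric (lipschitz_dual q)"
  unfolding is_metric_def
proof (intro conjI allI)
  fix x y z
  have "lipschitz_dual q x x = 0"
    using lipschitz_dual_le[of q x x 0, OF nonneg] le_lipschitz_dual[of "\<lambda>_. 0" q x x] nonneg
    by force
  then show "lipschitz_dual q x y = 0 \<longleftrightarrow> x = y"
    using pos[of x y] by (cases "x = y") auto
  show "lipschitz_dual q x y = lipschitz_dual q y x"
    unfolding lipschitz_dual_def by (simp add: abs_minus_commute)
  show "lipschitz_dual q x z \<le> lipschitz_dual q x y + lipschitz_dual q y z"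
  proof (rule lipschitz_dual_le[OF nonneg])
    fix f :: "'a \<Rightarrow> real"
    assume f: "\<And>z w. \<bar>f z - f w\<bar> \<le> q z w"
    show "\<bar>f x - f z\<bar> \<le> lipschitz_dual q x y + lipschitz_dual q y z"
      using le_lipschitz_dual[of f q x y, OF f] le_lipschitz_dual[of f q y z, OF f] by linarith
  qed
qed

section \<open>From ball growth to a metric doubling measure\<close>

lemma delta_measure_commute: "delta_measure \<nu> Q x y = delta_measure \<nu> Q y x"
  by (simp add: delta_measure_def dist_commute add.commute)

text \<open>The slope \<open>a\<close> is chosen so that \<open>growth\<close> inside
  \<open>ball x (2 * R)\<close> says that \<open>(a * s) powr Q\<close> is at most the measure of
  \<open>ball z s\<close>. Truncation at \<open>R\<close> makes the function constant off
  \<open>ball x R\<close>, so only pairs with a point in that ball matter.\<close>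

lemma truncated_distance_le_delta_measure:
  fixes \<nu> :: "'a::metric_space measure" and x :: 'a
  assumes sets: "sets \<nu> = sets borel" and Q: "Q \<ge> 1" and K: "K > 0"
    and fin: "\<And>x r. emeasure \<nu> (ball x r) < \<infinity>"
    and growth: "\<And>x r z s. 0 < s \<Longrightarrow> 0 < r \<Longrightarrow> ball z s \<subseteq> ball x r \<Longrightarrow>
      s powr Q * measure \<nu> (ball x r) \<le> K * r powr Q * measure \<nu> (ball z s)"
    and R: "R > 0"
  defines "a \<equiv> (measure \<nu> (ball x (2 * R)) / (K * (2 * R) powr Q)) powr (1 / Q)"
  shows "\<bar>a * min (dist x z) R - a * min (dist x w) R\<bar> \<le> delta_measure \<nu> Q z w"
proof -
  have a0: "a \<ge> 0"
    by (simp add: a_def)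
  have *: "\<bar>a * min (dist x z) R - a * min (dist x w) R\<bar> \<le> delta_measure \<nu> Q z w"
    if z: "dist x z < R" for z w
  proof (cases "z = w")
    case True
    then show ?thesis by (simp add: delta_measure_def)
  next
    case False
    \<comment> \<open>Capping the radius at \<open>R\<close> keeps \<open>ball z s\<close> inside
      \<open>ball x (2 * R)\<close> even when \<open>w\<close> is far away.\<close>
    define s where "s = min (dist z w) R"
    have s: "0 < s" "s \<le> R" "s \<le> dist z w"
      using False R by (auto simp: s_def)
    have sub: "ball z s \<subseteq> ball x (2 * R)"
    proof
      fix p assume "p \<in> ball z s"
      then show "p \<in> ball x (2 * R)"
        using z s dist_triangle[of x p z] by simp
    qed
    have g: "s powr Q * measure \<nu> (ball x (2 * R)) \<le> K * (2 * R) powr Q * measure \<nu> (ball z s)"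
      using growth[OF s(1) _ sub] R by simp
    have "s powr Q * (measure \<nu> (ball x (2 * R)) / (K * (2 * R) powr Q)) \<le> measure \<nu> (ball z s)"
      using g K R by (simp add: field_simps)
    also have "\<dots> \<le> measure \<nu> (ball z (dist z w))"
      by (rule measure_mono_fmeasurable) (use s fin in \<open>auto simp: sets fmeasurable_def\<close>)
    also have "\<dots> \<le> measure \<nu> (ball z (dist z w)) + measure \<nu> (ball w (dist z w))"
      by simp
    finally have "(s powr Q * (measure \<nu> (ball x (2 * R)) / (K * (2 * R) powr Q))) powr (1 / Q)
        \<le> delta_measure \<nu> Q z w"
      unfolding delta_measure_def using K Q by (intro powr_mono2) auto
    also have "(s powr Q * (measure \<nu> (ball x (2 * R)) / (K * (2 * R) powr Q))) powr (1 / Q) = s * a"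
      using s Q K by (subst powr_mult) (auto simp: a_def powr_powr)
    finally have d: "s * a \<le> delta_measure \<nu> Q z w" .
    \<comment> \<open>The bound by \<open>dist z w\<close> is the triangle inequality; the bound by
      \<open>R\<close> holds because both terms lie between 0 and \<open>R\<close>.\<close>
    have "\<bar>min (dist x z) R - min (dist x w) R\<bar> \<le> s"
      unfolding s_def using R dist_triangle[of x z w] dist_triangle[of x w z]
      using zero_le_dist[of x z] zero_le_dist[of x w] dist_commute[of w z] by linarith
    then have "a * \<bar>min (dist x z) R - min (dist x w) R\<bar> \<le> a * s"
      using a0 by (rule mult_left_mono)
    moreover have "\<bar>a * min (dist x z) R - a * min (dist x w) R\<bar>
        = a * \<bar>min (dist x z) R - min (dist x w) R\<bar>"
      using a0 by (simp add: abs_mult flip: right_diff_distrib)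
    ultimately show ?thesis
      using d by (simp add: mult.commute)
  qed
  consider "dist x z < R" | "dist x w < R" | "R \<le> dist x z" "R \<le> dist x w"
    by linarith
  then show ?thesis
  proof cases
    case 1
    then show ?thesis by (rule *)
  next
    case 2
    then show ?thesis
      using *[of w z] by (simp add: delta_measure_commute abs_minus_commute)
  next
    case 3
    then show ?thesis
      by (simp add: min_absorb2 delta_measure_def)
  qed
qed

text \<open>The metric is \<open>lipschitz_dual\<close> of \<open>delta_measure\<close>. It lies
  below \<open>delta_measure\<close> by construction; the reverse bound, up to a constant, needs one
  good test function per pair of points, the truncated distance.\<close>

lemma metric_doubling_measure_if_ball_growth:
  fixes \<nu> :: "'a::metric_space measure"
  assumes sets: "sets \<nu> = sets borel" and Q: "Q \<ge> 1" and K: "K > 0"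
    and fin: "\<And>x r. emeasure \<nu> (ball x r) < \<infinity>"
    and pos: "\<And>x r. 0 < r \<Longrightarrow> 0 < emeasure \<nu> (ball x r)"
    and growth: "\<And>x r z s. 0 < s \<Longrightarrow> 0 < r \<Longrightarrow> ball z s \<subseteq> ball x r \<Longrightarrow>
      s powr Q * measure \<nu> (ball x r) \<le> K * r powr Q * measure \<nu> (ball z s)"
  shows "metric_doubling_measure \<nu> Q"
proof -
  have em: "emeasure \<nu> (ball x r) = ennreal (measure \<nu> (ball x r))" for x r
    using fin[of x r] by (intro emeasure_eq_ennreal_measure) auto
  have mpos: "0 < measure \<nu> (ball x r)" if "0 < r" for x r
    using pos[OF that, of x] unfolding em by simp
  have doubling: "doubling_measure \<nu>"
    unfolding doubling_measure_def
  proof (intro exI allI impI conjI)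
    fix x :: 'a and r :: real assume r: "r > 0"
    show "0 < emeasure \<nu> (ball x r)" "emeasure \<nu> (ball x r) < \<infinity>"
      using pos[OF r] fin by auto
    \<comment> \<open>Growth for concentric balls: the factor \<open>r powr Q\<close> cancels and
      leaves the doubling constant \<open>K * 2 powr Q\<close>.\<close>
    have "ball x r \<subseteq> ball x (2 * r)"
      using r by (intro subset_ball) simp
    then have "r powr Q * measure \<nu> (ball x (2 * r)) \<le> K * (2 * r) powr Q * measure \<nu> (ball x r)"
      using r growth[of r "2 * r" x x] by simp
    then have "measure \<nu> (ball x (2 * r)) \<le> (K * 2 powr Q) * measure \<nu> (ball x r)"
      using r by (simp add: powr_mult mult.assoc mult.left_commute[of _ "r powr Q"])
    then show "emeasure \<nu> (ball x (2 * r)) \<le> ennreal (K * 2 powr Q) * emeasure \<nu> (ball x r)"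
      using K by (simp add: em flip: ennreal_mult)
  qed
  define q where "q = delta_measure \<nu> Q"
  \<comment> \<open>The second argument is the ratio of \<open>(2 * m) powr (1 / Q)\<close> to
    \<open>a * R\<close> in the proof of \<open>lower\<close>; the maximum with 1 lets the same
    constant serve for the upper bound.\<close>
  define C where "C = max 1 (2 * (2 * K) powr (1 / Q))"
  have q0: "0 \<le> q z w" for z w
    by (simp add: q_def delta_measure_def)
  have upper: "lipschitz_dual q x y \<le> q x y" for x y
    by (rule lipschitz_dual_le[OF q0])
  have qpos: "0 < q x y" if "x \<noteq> y" for x y
    using mpos[of "dist x y" x] mpos[of "dist x y" y] that
    by (simp add: q_def delta_measure_def)
  have lower: "q x y \<le> C * lipschitz_dual q x y" if "x \<noteq> y" for x y
  proof -
    define R where "R = dist x y"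
    have R: "R > 0"
      using that by (simp add: R_def)
    define m where "m = measure \<nu> (ball x (2 * R))"
    define a where "a = (m / (K * (2 * R) powr Q)) powr (1 / Q)"
    \<comment> \<open>The test function vanishes at \<open>x\<close> and equals \<open>a * R\<close>
      at \<open>y\<close>.\<close>
    have "\<bar>a * min (dist x x) R - a * min (dist x y) R\<bar> \<le> lipschitz_dual q x y"
      by (rule le_lipschitz_dual, unfold a_def m_def q_def)
        (rule truncated_distance_le_delta_measure[OF sets Q K fin growth R])
    then have aR: "a * R \<le> lipschitz_dual q x y"
      using R by (simp add: R_def abs_if split: if_splits)
    have "measure \<nu> (ball x R) + measure \<nu> (ball y R) \<le> m + m"
      unfolding m_def
    proof (intro add_mono measure_mono_fmeasurable)
      show "ball y R \<subseteq> ball x (2 * R)"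
      proof
        fix p assume "p \<in> ball y R"
        then show "p \<in> ball x (2 * R)"
          using dist_triangle[of x p y] by (simp add: R_def)
      qed
    qed (use R fin in \<open>auto simp: sets fmeasurable_def\<close>)
    then have "q x y \<le> (2 * m) powr (1 / Q)"
      unfolding q_def delta_measure_def R_def using Q by (intro powr_mono2) auto
    also have "2 * m = 2 * K * (2 * R) powr Q * (m / (K * (2 * R) powr Q))"
      using K R by simp
    also have "\<dots> powr (1 / Q) = (2 * K) powr (1 / Q) * (2 * R) * a"
      using K R Q by (simp add: a_def m_def powr_mult powr_powr powr_divide)
    also have "\<dots> = (2 * (2 * K) powr (1 / Q)) * (a * R)"
      by simp
    also have "\<dots> \<le> C * lipschitz_dual q x y"
      by (intro mult_mono aR) (use R in \<open>auto simp: C_def a_def\<close>)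
    finally show ?thesis .
  qed
  have C: "C \<ge> 1"
    by (simp add: C_def)
  have metric: "is_metric (lipschitz_dual q)"
  proof (rule is_metric_lipschitz_dual[OF q0])
    fix x y :: 'a assume "x \<noteq> y"
    then have "0 < C * lipschitz_dual q x y"
      using qpos lower by (meson less_le_trans)
    then show "0 < lipschitz_dual q x y"
      using C by (simp add: zero_less_mult_iff)
  qed
  have "lipschitz_dual q x y / C \<le> q x y \<and> q x y \<le> C * lipschitz_dual q x y" for x y
  \<comment> \<open>On the diagonal both sides vanish, the balls of radius 0 being empty.\<close>
  proof (cases "x = y")
    case True
    have "lipschitz_dual q x y = 0"
      using metric True by (simp add: is_metric_def)
    then show ?thesis
      using True by (simp add: q_def delta_measure_def)
  next
    case False
    have "lipschitz_dual q x y \<le> C * q x y"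
      using upper[of x y] mult_right_mono[OF C q0[of x y]] by simp
    then show ?thesis
      using lower[OF False] C by (simp add: field_simps)
  qed
  then show ?thesis
    unfolding metric_doubling_measure_def
    using doubling metric C q_def by (metis less_le_trans zero_less_one)
qed

section \<open>Essential infima and ball growth for \<open>A1_weight\<close>\<close>

lemma AE_ess_inf_on_le: "AE y in \<mu>. y \<in> B \<longrightarrow> ess_inf_on \<mu> B f \<le> f y"
proof -
  let ?S = "{t. AE y in \<mu>. y \<in> B \<longrightarrow> t \<le> f y}"
  have "0 \<in> ?S" by simp
  then have "?S \<noteq> {}" by blast
  \<comment> \<open>The supremum may range over uncountably many bounds; a sequence with the same
    supremum leaves only countably many exceptional null sets.\<close>
  then obtain h :: "nat \<Rightarrow> ennreal" where h: "range h \<subseteq> ?S" "Sup ?S = (SUP n. h n)"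
    using ennreal_Sup_countable_SUP[of ?S] by auto
  have "AE y in \<mu>. \<forall>n. y \<in> B \<longrightarrow> h n \<le> f y"
    unfolding AE_all_countable using h(1) by blast
  then show ?thesis
    unfolding ess_inf_on_def h(2) by eventually_elim (auto intro: SUP_least)
qed

text \<open>Integrating the lower bound over the smaller set carries information from a large ball
  to any ball inside it.\<close>

lemma ess_inf_on_times_emeasure_le:
  assumes f: "f \<in> borel_measurable \<mu>" and A: "A \<in> sets \<mu>" and sub: "A \<subseteq> B"
  shows "ess_inf_on \<mu> B f * emeasure \<mu> A \<le> emeasure (density \<mu> f) A"
proof -
  have "ess_inf_on \<mu> B f * emeasure \<mu> A = (\<integral>\<^sup>+ y. ess_inf_on \<mu> B f * indicator A y \<partial>\<mu>)"
    using A by (simp add: nn_integral_cmult_indicator)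
  also have "\<dots> \<le> (\<integral>\<^sup>+ y. f y * indicator A y \<partial>\<mu>)"
  proof (rule nn_integral_mono_AE)
    show "AE y in \<mu>. ess_inf_on \<mu> B f * indicator A y \<le> f y * indicator A y"
      using AE_ess_inf_on_le[where \<mu> = \<mu> and B = B and f = f]
      by eventually_elim (use sub in \<open>auto simp: indicator_def\<close>)
  qed
  also have "\<dots> = emeasure (density \<mu> f) A"
    using f A by (simp add: emeasure_density)
  finally show ?thesis .
qed

text \<open>Otherwise the finite-valued \<open>f\<close> would be infinite at almost every point of
  a set of positive measure.\<close>

lemma ess_inf_on_less_top:
  assumes "B \<in> sets \<mu>" and "emeasure \<mu> B \<noteq> 0" and "\<And>y. f y < \<infinity>"
  shows "ess_inf_on \<mu> B f < \<infinity>"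
proof (rule ccontr)
  assume "\<not> ?thesis"
  then have "ess_inf_on \<mu> B f = \<infinity>"
    by (metis infinity_ennreal_def less_top)
  with AE_ess_inf_on_le[where \<mu> = \<mu> and B = B and f = f] have "AE y in \<mu>. y \<notin> B"
    by (elim eventually_mono) (use assms(3) in \<open>auto simp: not_le[symmetric]\<close>)
  then show False
    using assms(1,2) by (metis AE_iff_null_sets null_setsD1)
qed

text \<open>The essential infimum over the large ball controls both sides: the A1 condition bounds
  the mass of the large ball above by it, and it bounds the weight below on the small ball. Ahlfors
  regularity turns \<open>\<mu>\<close>-measures into powers of the radii.\<close>

lemma A1_weight_ball_growth:
  fixes \<mu> :: "'a::metric_space measure" and \<omega> :: "'a \<Rightarrow> real"
  assumes sets: "sets \<mu> = sets borel" and ahlfors: "ahlfors_regular \<mu> Q" and A1: "A1_weight \<mu> \<omega>"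
  defines "\<nu> \<equiv> density \<mu> (\<lambda>x. ennreal (\<omega> x))"
  obtains K where "K > 0" and "\<And>x r. emeasure \<nu> (ball x r) < \<infinity>"
    and "\<And>x r z s. 0 < s \<Longrightarrow> 0 < r \<Longrightarrow> ball z s \<subseteq> ball x r \<Longrightarrow>
      s powr Q * measure \<nu> (ball x r) \<le> K * r powr Q * measure \<nu> (ball z s)"
proof -
  let ?w = "\<lambda>x. ennreal (\<omega> x)"
  obtain A where A: "A \<ge> 1"
    and Alow: "\<And>x r. r > 0 \<Longrightarrow> ennreal (r powr Q / A) \<le> emeasure \<mu> (ball x r)"
    and Aup: "\<And>x r. r > 0 \<Longrightarrow> emeasure \<mu> (ball x r) \<le> ennreal (A * r powr Q)"
    using ahlfors unfolding ahlfors_regular_def by blast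
  obtain c where c: "c > 0"
    and cmean: "\<And>x r. r > 0 \<Longrightarrow>
      (\<integral>\<^sup>+ y \<in> ball x r. ?w y \<partial>\<mu>) / emeasure \<mu> (ball x r) \<le> ennreal c * ess_inf_on \<mu> (ball x r) ?w"
    using A1 unfolding A1_weight_def by blast
  have meas: "?w \<in> borel_measurable \<mu>"
    using A1 by (simp add: A1_weight_def)
  have balls: "ball x r \<in> sets \<mu>" for x r
    by (simp add: sets)
  have upper: "emeasure \<nu> (ball x r)
      \<le> ennreal c * ess_inf_on \<mu> (ball x r) ?w * ennreal (A * r powr Q)" if r: "r > 0" for x r
  proof -
    have "0 < ennreal (r powr Q / A)"
      using r A by simp
    then have M0: "emeasure \<mu> (ball x r) \<noteq> 0"
      using Alow[OF r, of x] by auto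
    have Minf: "emeasure \<mu> (ball x r) < top"
      using Aup[OF r, of x] by (auto intro: le_less_trans)
    \<comment> \<open>Cancelling in \<open>ennreal\<close> requires
      \<open>emeasure \<mu> (ball x r)\<close> to be neither 0 nor infinite, which Ahlfors
      regularity ensures.\<close>
    have "emeasure \<nu> (ball x r) = emeasure \<nu> (ball x r) / emeasure \<mu> (ball x r) * emeasure \<mu> (ball x r)"
      using M0 Minf by (simp add: ennreal_divide_times ennreal_divide_self)
    also have "\<dots> \<le> ennreal c * ess_inf_on \<mu> (ball x r) ?w * ennreal (A * r powr Q)"
      using cmean[OF r, of x] Aup[OF r, of x] balls meas
      by (intro mult_mono) (auto simp: \<nu>_def emeasure_density)
    finally show ?thesis .
  qed
  have Ifin: "ess_inf_on \<mu> (ball x r) ?w < \<infinity>" if r: "r > 0" for x r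
  proof (rule ess_inf_on_less_top[OF balls])
    have "0 < ennreal (r powr Q / A)"
      using r A by simp
    then show "emeasure \<mu> (ball x r) \<noteq> 0"
      using Alow[OF r, of x] by auto
  qed simp
  have fin: "emeasure \<nu> (ball x r) < \<infinity>" for x r
  proof (cases "r > 0")
    case True
    then have "ennreal c * ess_inf_on \<mu> (ball x r) ?w * ennreal (A * r powr Q) < \<infinity>"
      using Ifin[OF True, of x] by (simp add: ennreal_mult_less_top)
    then show ?thesis
      using upper[OF True, of x] by (rule le_less_trans[rotated])
  next
    case False
    then show ?thesis by (simp add: ball_empty)
  qed
  have em: "emeasure \<nu> (ball x r) = ennreal (measure \<nu> (ball x r))" for x r
    using fin[of x r] by (intro emeasure_eq_ennreal_measure) auto
  show thesis
  proof (rule that)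
    \<comment> \<open>One factor \<open>A\<close> comes from the upper Ahlfors bound on the large
      ball, the other from the lower bound on the small ball.\<close>
    show "c * A\<^sup>2 > 0"
      using c A by simp
    show "emeasure \<nu> (ball x r) < \<infinity>" for x r
      by (rule fin)
    fix x z :: 'a and r s :: real
    assume s: "0 < s" and r: "0 < r" and sub: "ball z s \<subseteq> ball x r"
    obtain i where i: "i \<ge> 0" "ess_inf_on \<mu> (ball x r) ?w = ennreal i"
      using Ifin[OF r, of x] by (metis ennreal_cases infinity_ennreal_def less_irrefl)
    have "ennreal (measure \<nu> (ball x r)) \<le> ennreal (c * i * (A * r powr Q))"
      using upper[OF r, of x] i c A by (simp add: em ennreal_mult)
    then have up: "measure \<nu> (ball x r) \<le> c * i * (A * r powr Q)"
      using i c A by (subst (asm) ennreal_le_iff) auto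
    have "ennreal i * ennreal (s powr Q / A) \<le> ennreal i * emeasure \<mu> (ball z s)"
      by (intro mult_left_mono Alow s) simp
    also have "\<dots> \<le> ennreal (measure \<nu> (ball z s))"
      using ess_inf_on_times_emeasure_le[OF meas balls sub] i by (simp add: em flip: \<nu>_def)
    finally have "ennreal (i * (s powr Q / A)) \<le> ennreal (measure \<nu> (ball z s))"
      using i A by (subst ennreal_mult) auto
    then have low: "i * (s powr Q / A) \<le> measure \<nu> (ball z s)"
      by (subst (asm) ennreal_le_iff) auto
    have "s powr Q * measure \<nu> (ball x r) \<le> s powr Q * (c * i * (A * r powr Q))"
      using up by (intro mult_left_mono) auto
    also have "\<dots> = c * A\<^sup>2 * r powr Q * (i * (s powr Q / A))"
      using A by (simp add: field_simps power2_eq_square)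
    also have "\<dots> \<le> c * A\<^sup>2 * r powr Q * measure \<nu> (ball z s)"
      using low c by (intro mult_left_mono) auto
    finally show "s powr Q * measure \<nu> (ball x r) \<le> c * A\<^sup>2 * r powr Q * measure \<nu> (ball z s)" .
  qed
qed

section \<open>Positivity on balls, local integrability and conclusion\<close>

theorem theorem2p2:
  fixes \<mu> :: "'a::metric_space measure" and Q :: real and \<omega> :: "'a \<Rightarrow> real"
  assumes "sets \<mu> = sets borel"
    and "Q \<ge> 1"
    and "ahlfors_regular \<mu> Q"
    and "weak_11_poincare \<mu>"
    and "A1_weight \<mu> \<omega>"
    and "\<not> (AE x in \<mu>. \<omega> x = 0)"
  shows "strong_A_infinity_weight \<mu> Q \<omega>"
proof -
  define \<nu> where "\<nu> = density \<mu> (\<lambda>x. ennreal (\<omega> x))"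
  have meas: "\<omega> \<in> borel_measurable \<mu>" and nonneg: "\<And>x. 0 \<le> \<omega> x"
    using assms(5) by (auto simp: A1_weight_def)
  have balls: "ball x r \<in> sets \<mu>" for x r
    by (simp add: assms(1))
  obtain K where K: "K > 0" and fin: "\<And>x r. emeasure \<nu> (ball x r) < \<infinity>"
    and growth: "\<And>x r z s. 0 < s \<Longrightarrow> 0 < r \<Longrightarrow> ball z s \<subseteq> ball x r \<Longrightarrow>
      s powr Q * measure \<nu> (ball x r) \<le> K * r powr Q * measure \<nu> (ball z s)"
    using A1_weight_ball_growth[OF assms(1,3,5)] unfolding \<nu>_def by metis
  have em: "emeasure \<nu> (ball x r) = ennreal (measure \<nu> (ball x r))" for x r
    using fin[of x r] by (intro emeasure_eq_ennreal_measure) auto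
  \<comment> \<open>By \<open>growth\<close> a null ball makes all larger concentric balls null.
    These exhaust the space, so the weight would vanish almost everywhere, which the last assumption
    excludes.\<close>
  have pos: "0 < emeasure \<nu> (ball x r)" if r: "0 < r" for x r
  proof (rule ccontr)
    assume "\<not> ?thesis"
    then have zero: "measure \<nu> (ball x r) = 0"
      by (simp add: measure_def)
    have null: "ball x (r + real n) \<in> null_sets \<nu>" for n
    proof -
      have "ball x r \<subseteq> ball x (r + real n)"
        by (intro subset_ball) simp
      then have "r powr Q * measure \<nu> (ball x (r + real n)) \<le> 0"
        using growth[of r "r + real n" x x] r zero by simp
      then have "measure \<nu> (ball x (r + real n)) = 0"
        using r by (simp add: mult_le_0_iff measure_le_0_iff)
      then show ?thesis
        using em[of x "r + real n"] balls by (simp add: null_sets_def \<nu>_def)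
    qed
    have "(\<Union>n. ball x (r + real n)) \<in> null_sets \<nu>"
      by (intro null_sets_UN null)
    moreover have "(\<Union>n. ball x (r + real n)) = UNIV"
    proof -
      have "\<exists>n. dist x y < r + real n" for y
        using reals_Archimedean2[of "dist x y"] r by (meson add_strict_mono add_0 less_trans pos_add_strict)
      then show ?thesis by auto
    qed
    ultimately have "UNIV \<in> null_sets \<nu>" by simp
    then have "AE y in \<mu>. ennreal (\<omega> y) = 0"
      using meas by (simp add: \<nu>_def null_sets_density_iff)
    then have "AE y in \<mu>. \<omega> y = 0"
      by eventually_elim (use nonneg in \<open>simp add: order_antisym\<close>)
    with assms(6) show False by contradiction
  qed
  \<comment> \<open>As the weight is nonnegative, its integral over a ball is the
    \<open>\<nu>\<close>-mass of the ball, finite by \<open>fin\<close>.\<close>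
  have "loc_integrable \<mu> \<omega>"
    unfolding loc_integrable_def set_integrable_def
  proof (intro conjI allI meas integrableI_bounded)
    fix x :: 'a and r :: real
    show "(\<lambda>y. indicat_real (ball x r) y *\<^sub>R \<omega> y) \<in> borel_measurable \<mu>"
      using meas balls by measurable
    have "(\<integral>\<^sup>+ y. ennreal (norm (indicat_real (ball x r) y *\<^sub>R \<omega> y)) \<partial>\<mu>)
        = (\<integral>\<^sup>+ y. ennreal (\<omega> y) * indicator (ball x r) y \<partial>\<mu>)"
      by (rule nn_integral_cong) (use nonneg in \<open>auto simp: indicator_def\<close>)
    also have "\<dots> = emeasure \<nu> (ball x r)"
      using meas balls by (simp add: \<nu>_def emeasure_density)
    finally show "(\<integral>\<^sup>+ y. ennreal (norm (indicat_real (ball x r) y *\<^sub>R \<omega> y)) \<partial>\<mu>) < \<infinity>"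
      using fin by simp
  qed
  moreover have "metric_doubling_measure \<nu> Q"
    by (rule metric_doubling_measure_if_ball_growth[OF _ assms(2) K fin pos growth])
      (use assms(1) in \<open>auto simp: \<nu>_def\<close>)
  ultimately show ?thesis
    using nonneg by (simp add: strong_A_infinity_weight_def \<nu>_def)
qed

end
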